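(* For every positive integer $t\le 22$, every graph $G$ on $4t-1$ vertices with $\alpha(G)=2$ satisfies $\mathrm{cm}(G)\ge t$.
   Context: All graphs are finite and simple. $\alpha(G)$ is the independence number. A matching $M$ in $G$ is connected if for every two edges of $M$ there is an edge of $G$ joining an endpoint of one to an endpoint of the other; $\mathrm{cm}(G)$ is the maximum size of a connected matching in $G$. *)

theory Defs
  imports Main
begin

definition simple_graph :: "'a set \<Rightarrow> ('a \<Rightarrow> 'a \<Rightarrow> bool) \<Rightarrow> bool" where
  "simple_graph V E \<longleftrightarrow> finite V \<and> (\<forall>x y. E x y \<longrightarrow> x \<in> V \<and> y \<in> V)
     \<and> (\<forall>x y. E x y \<longrightarrow> E y x) \<and> (\<forall>x. \<not> E x x)"

definition independent_set :: "'a set \<Rightarrow> ('a \<Rightarrow> 'a \<Rightarrow> bool) \<Rightarrow> 'a set \<Rightarrow> bool" where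
  "independent_set V E S \<longleftrightarrow> S \<subseteq> V \<and> (\<forall>x\<in>S. \<forall>y\<in>S. \<not> E x y)"

definition alpha :: "'a set \<Rightarrow> ('a \<Rightarrow> 'a \<Rightarrow> bool) \<Rightarrow> nat" where
  "alpha V E = Max (card ` {S. independent_set V E S})"

definition is_edge :: "('a \<Rightarrow> 'a \<Rightarrow> bool) \<Rightarrow> 'a set \<Rightarrow> bool" where
  "is_edge E e \<longleftrightarrow> (\<exists>x y. e = {x, y} \<and> E x y)"

definition matching :: "('a \<Rightarrow> 'a \<Rightarrow> bool) \<Rightarrow> 'a set set \<Rightarrow> bool" where
  "matching E M \<longleftrightarrow> (\<forall>e\<in>M. is_edge E e) \<and> (\<forall>e\<in>M. \<forall>f\<in>M. e \<noteq> f \<longrightarrow> e \<inter> f = {})"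

definition connected_matching :: "('a \<Rightarrow> 'a \<Rightarrow> bool) \<Rightarrow> 'a set set \<Rightarrow> bool" where
  "connected_matching E M \<longleftrightarrow> matching E M \<and>
     (\<forall>e\<in>M. \<forall>f\<in>M. e \<noteq> f \<longrightarrow> (\<exists>x\<in>e. \<exists>y\<in>f. E x y))"

definition cm :: "'a set \<Rightarrow> ('a \<Rightarrow> 'a \<Rightarrow> bool) \<Rightarrow> nat" where
  "cm V E = Max (card ` {M. connected_matching E M})"

end

(*
  Let k be the clique number. As alpha(G) = 2, the non-neighbours of a vertex form a
  clique, so every vertex has at most k non-neighbours. If k >= t - 1, edges from a clique to
  distinct outside vertices, plus one edge disjoint from the clique when k = t - 1, are chosen
  greedily. If k <= t - 2, pair up all but one of the vertices at random, giving 2t - 1 pairs.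
  On average at most k/2 pairs are non-edges. Two pairs fail to be connected only if they
  are the diagonals of a 4-cycle in the complement, and there are at most n k (k - 1)^2 / 8
  such cycles, which yields at most k (k - 1)^2 / (8 (n - 2)) unconnected couples of pairs on
  average. For t <= 22 these two averages add up to less than t, so removing the offending
  pairs leaves at least t.
*)

theory Submission
  imports Defs Complex_Main "HOL-Combinatorics.Permutations"
begin

section \<open>Permutations with prescribed images of a list\<close>

text \<open>Both lists are completed to enumerations of \<open>V\<close>, and entries at equal
  positions are matched.\<close>

lemma ex_permutes_map:
  assumes "finite V" "distinct xs" "set xs \<subseteq> V" "distinct ys" "set ys \<subseteq> V"
    and "length xs = length ys"
  shows "\<exists>p. p permutes V \<and> map p xs = ys"
proof -
  obtain us where us: "set us = V - set xs" "distinct us"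
    using finite_distinct_list[of "V - set xs"] assms(1) by auto
  obtain vs where vs: "set vs = V - set ys" "distinct vs"
    using finite_distinct_list[of "V - set ys"] assms(1) by auto
  have "length us = length vs"
    using us vs assms
    by (metis card_Diff_subset distinct_card finite_set)
  define zs where "zs = zip (xs @ us) (ys @ vs)"
  have len: "length (xs @ us) = length (ys @ vs)"
    using assms \<open>length us = length vs\<close> by simp
  have dx: "distinct (xs @ us)" and dy: "distinct (ys @ vs)"
    using us vs assms by auto
  have "list_permutes zs V"
    unfolding list_permutes_def zs_def using len dx dy us vs assms
    by (simp add: map_fst_zip map_snd_zip del: map_append zip_append) auto
  then have p: "permutation_of_list zs permutes V"
    by (rule permutation_of_list_permutes)
  have "map (permutation_of_list zs) (xs @ us) = ys @ vs"
  proof (rule nth_equalityI)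
    fix i assume "i < length (map (permutation_of_list zs) (xs @ us))"
    then have i: "i < length (xs @ us)" by simp
    have "map_of zs ((xs @ us) ! i) = Some ((ys @ vs) ! i)"
      unfolding zs_def using map_of_zip_nth[OF len dx, of i] len i by simp
    then show "map (permutation_of_list zs) (xs @ us) ! i = (ys @ vs) ! i"
      using i by (simp add: permutation_of_list_def del: map_append)
  qed (use len in simp)
  then have "map (permutation_of_list zs) xs = ys"
    using assms(6) by simp
  with p show ?thesis by blast
qed

text \<open>A uniformly random permutation sends \<open>xs\<close> to a uniformly random element of
  \<open>D\<close>, so the image lands in \<open>P\<close> with probability
  \<open>card P / card D\<close>; the products avoid division in the natural numbers.\<close>

lemma card_permutes_map_in:
  fixes V :: "'a set"
  assumes "finite V" "distinct xs" "set xs \<subseteq> V"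
  defines "D \<equiv> {ys. length ys = length xs \<and> distinct ys \<and> set ys \<subseteq> V}"
  assumes "P \<subseteq> D"
  shows "card {p. p permutes V \<and> map p xs \<in> P} * card D = fact (card V) * card P"
proof -
  define F where "F ys = {p. p permutes V \<and> map p xs = ys}" for ys
  have finF: "finite (F ys)" for ys
    unfolding F_def using finite_permutations[OF assms(1)] by simp
  have finD: "finite D"
    unfolding D_def using finite_lists_length_eq[OF assms(1), of "length xs"]
    by (rule rev_finite_subset) auto
  \<comment> \<open>All fibres have equal size: composing with a permutation that takes
    \<open>ys\<close> to \<open>zs\<close> injects one fibre into the other.\<close>
  have le: "card (F ys) \<le> card (F zs)" if ys: "ys \<in> D" and zs: "zs \<in> D" for ys zs
  proof -
    obtain q where q: "q permutes V" "map q ys = zs"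
      using ex_permutes_map[OF assms(1), of ys zs] ys zs unfolding D_def by auto
    have "inj_on (\<lambda>p. q \<circ> p) (F ys)"
      by (rule inj_onI) (metis fun.inj_map_strong injD permutes_inj q(1))
    moreover have "(\<lambda>p. q \<circ> p) ` F ys \<subseteq> F zs"
      unfolding F_def using q by (auto intro: permutes_compose)
    ultimately show ?thesis
      using card_inj_on_le finF by blast
  qed
  have eq: "card (F ys) = card (F xs)" if "ys \<in> D" for ys
    using le[of ys xs] le[of xs ys] that assms by (simp add: D_def)
  have *: "card {p. p permutes V \<and> map p xs \<in> Q} = card Q * card (F xs)" if "Q \<subseteq> D" for Q
  proof -
    have "{p. p permutes V \<and> map p xs \<in> Q} = (\<Union>ys\<in>Q. F ys)"
      unfolding F_def by auto
    also have "card \<dots> = (\<Sum>ys\<in>Q. card (F ys))"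
      using finite_subset[OF that finD] finF
      by (intro card_UN_disjoint) (auto simp: F_def)
    also have "\<dots> = (\<Sum>ys\<in>Q. card (F xs))"
      using eq that by (intro sum.cong) auto
    finally show ?thesis by simp
  qed
  have "{p. p permutes V \<and> map p xs \<in> D} = {p. p permutes V}"
    using assms(2,3)
    by (auto simp: D_def distinct_map permutes_in_image
        intro: inj_on_subset[OF permutes_inj])
  then have "fact (card V) = card D * card (F xs)"
    using *[of D] card_permutations[OF refl assms(1)] by simp
  then show ?thesis
    using *[OF assms(5)] by simp
qed

section \<open>Counting edges and 4-cycles by degrees\<close>

lemma card_adjacent_pairs_le:
  assumes "finite V" "\<And>x. x \<in> V \<Longrightarrow> card {y\<in>V. R x y} \<le> k"
  shows "card {[x, y] |x y. x \<in> V \<and> y \<in> V \<and> x \<noteq> y \<and> R x y} \<le> card V * k"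
proof -
  have "{[x, y] |x y. x \<in> V \<and> y \<in> V \<and> x \<noteq> y \<and> R x y}
      \<subseteq> (\<lambda>(x, y). [x, y]) ` (SIGMA x:V. {y\<in>V. R x y})"
    by auto
  then have "card {[x, y] |x y. x \<in> V \<and> y \<in> V \<and> x \<noteq> y \<and> R x y}
      \<le> card (SIGMA x:V. {y\<in>V. R x y})"
    by (rule surj_card_le[rotated]) (use assms(1) in auto)
  also have "\<dots> = (\<Sum>x\<in>V. card {y\<in>V. R x y})"
    using assms(1) by simp
  also have "\<dots> \<le> (\<Sum>x\<in>V. k)"
    using assms(2) by (rule sum_mono)
  finally show ?thesis by simp
qed

text \<open>Every 4-cycle is listed eight times, once for each order of its diagonals and of their ends.\<close>

lemma card_four_cycles_le:
  assumes "finite V" and sym: "\<And>x y. R x y \<Longrightarrow> R y x"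
    and deg: "\<And>x. x \<in> V \<Longrightarrow> card {y\<in>V. R x y} \<le> k"
  shows "card {[x, x', y, y'] |x x' y y'. {x, x', y, y'} \<subseteq> V \<and> distinct [x, x', y, y'] \<and>
           R x y \<and> R x y' \<and> R x' y \<and> R x' y'} \<le> card V * (k * ((k - 1) * (k - 1)))"
    (is "card ?C \<le> _")
proof -
  define N where "N x = {y\<in>V. R x y}" for x
  have finN: "finite (N x)" for x
    using assms(1) by (simp add: N_def)
  \<comment> \<open>Choose \<open>x\<close>, a neighbour \<open>y\<close> of \<open>x\<close>,
    another neighbour \<open>y'\<close> of \<open>x\<close> and another neighbour \<open>x'\<close>
    of \<open>y\<close>. The fourth relation \<open>R x' y'\<close> is dropped, which only enlarges
    the count.\<close>
  let ?S = "SIGMA x:V. SIGMA y:N x. (N x - {y}) \<times> (N y - {x})"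
  have "?C \<subseteq> (\<lambda>(x, y, y', x'). [x, x', y, y']) ` ?S"
    unfolding N_def using sym by (auto simp: image_iff)
  then have "card ?C \<le> card ?S"
    by (rule surj_card_le[rotated]) (use assms(1) finN in auto)
  also have "\<dots> = (\<Sum>x\<in>V. \<Sum>y\<in>N x. card (N x - {y}) * card (N y - {x}))"
    using assms(1) finN by (simp add: card_cartesian_product)
  also have "\<dots> \<le> (\<Sum>x\<in>V. \<Sum>y\<in>N x. (k - 1) * (k - 1))"
  proof (intro sum_mono mult_le_mono)
    fix x y assume "x \<in> V" "y \<in> N x"
    then have "y \<in> V" "x \<in> N y" "card (N x) \<le> k" "card (N y) \<le> k"
      using sym deg by (auto simp: N_def)
    then show "card (N x - {y}) \<le> k - 1" "card (N y - {x}) \<le> k - 1"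
      using \<open>y \<in> N x\<close> by auto
  qed
  also have "\<dots> = (\<Sum>x\<in>V. card (N x) * ((k - 1) * (k - 1)))"
    by simp
  also have "\<dots> \<le> (\<Sum>x\<in>V. k * ((k - 1) * (k - 1)))"
    using deg by (intro sum_mono mult_le_mono) (auto simp: N_def)
  finally show ?thesis by simp
qed

section \<open>A random pairing with few conflicts\<close>

text \<open>First-moment argument, with \<open>R\<close> standing for non-adjacency. Each of the
  \<open>m\<close> pairs is bad with probability at most \<open>k / (2m)\<close>, and each of the
  \<open>m(m-1)/2\<close> couples of pairs with probability at most
  \<open>k(k-1)^2 / ((2m-1) 4m(m-1))\<close>; the left side of \<open>small\<close> is the sum of
  these bounds. A couple is recorded once, larger index first.\<close>

lemma ex_pairing_few_conflicts:
  fixes V :: "'a set" and R :: "'a \<Rightarrow> 'a \<Rightarrow> bool"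
  assumes fin: "finite V" and cardV: "card V = 2 * m + 1" and m: "2 \<le> m"
    and sym: "\<And>x y. R x y \<Longrightarrow> R y x"
    and deg: "\<And>x. x \<in> V \<Longrightarrow> card {y\<in>V. R x y} \<le> k"
    and small: "real k / 2 + real (k * ((k - 1) * (k - 1))) / (8 * (2 * real m - 1)) < real s"
  obtains a b :: "nat \<Rightarrow> 'a" where
    "\<forall>i<m. a i \<in> V \<and> b i \<in> V"
    "\<forall>i<m. \<forall>j<m. a i \<noteq> b j"
    "inj_on a {..<m}" "inj_on b {..<m}"
    "card {i. i < m \<and> R (a i) (b i)} + card {(j, i). j < m \<and> i < j \<and>
       R (a i) (a j) \<and> R (a i) (b j) \<and> R (b i) (a j) \<and> R (b i) (b j)} < s"
proof -
  let ?n = "card V"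
  obtain h where h: "bij_betw h {..<?n} V"
    using ex_bij_betw_nat_finite[OF fin] by (auto simp: atLeast0LessThan)
  \<comment> \<open>Consecutive positions \<open>2i\<close> and \<open>2i + 1\<close> of a fixed
    enumeration are paired; the last position, \<open>2m\<close>, stays single. Randomness enters by
    permuting \<open>V\<close>.\<close>
  define a where "a i = h (2 * i)" for i
  define b where "b i = h (2 * i + 1)" for i
  have hin: "h i \<in> V" if "i < ?n" for i
    using h that by (auto simp: bij_betw_def)
  have heq: "h i = h j \<longleftrightarrow> i = j" if "i < ?n" "j < ?n" for i j
    using h that by (auto simp: bij_betw_def inj_on_def)
  have ab: "a i \<in> V" "b i \<in> V" if "i < m" for i
    using that cardV hin by (auto simp: a_def b_def)
  have aa: "a i = a j \<longleftrightarrow> i = j" if "i < m" "j < m" for i j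
    using that cardV by (simp add: a_def heq)
  have bb: "b i = b j \<longleftrightarrow> i = j" if "i < m" "j < m" for i j
    using that cardV by (simp add: b_def heq)
  have neq: "a i \<noteq> b j" if "i < m" "j < m" for i j
    using that cardV by (simp add: a_def b_def heq) presburger
  define S where "S = {p. p permutes V}"
  define N where "N = (fact ?n :: nat)"
  have finS: "finite S" and cardS: "card S = N"
    unfolding S_def N_def using fin finite_permutations card_permutations by auto
  define L where "L p i \<longleftrightarrow> R (p (a i)) (p (b i))" for p i
  define C where "C p i j \<longleftrightarrow> R (p (a i)) (p (a j)) \<and> R (p (a i)) (p (b j)) \<and>
    R (p (b i)) (p (a j)) \<and> R (p (b i)) (p (b j))" for p i j
  define w where "w p = card {i. i < m \<and> L p i} + card {(j, i). j < m \<and> i < j \<and> C p i j}" for p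
  \<comment> \<open>At most \<open>n k\<close> of the \<open>n (n - 1)\<close> ordered pairs are
    related, where \<open>n = card V\<close> and \<open>n - 1 = 2m\<close>; the common factor
    \<open>n\<close> is cancelled.\<close>
  have L_le: "2 * real m * card {p\<in>S. L p i} \<le> real N * k" if i: "i < m" for i
  proof -
    let ?P = "{[x, y] |x y. x \<in> V \<and> y \<in> V \<and> x \<noteq> y \<and> R x y}"
    have d: "distinct [a i, b i]" "set [a i, b i] \<subseteq> V"
      using i ab neq by auto
    have P: "?P \<subseteq> {ys. length ys = length [a i, b i] \<and> distinct ys \<and> set ys \<subseteq> V}"
      by auto
    have "map p [a i, b i] \<in> ?P \<longleftrightarrow> L p i" if "p permutes V" for p
      using d permutes_in_image[OF that] permutes_inj[OF that, THEN inj_eq] by (simp add: L_def)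
    then have eq: "{p\<in>S. L p i} = {p. p permutes V \<and> map p [a i, b i] \<in> ?P}"
      by (intro Collect_cong) (simp only: S_def mem_Collect_eq cong: conj_cong)
    have D: "card {ys::'a list. length ys = length [a i, b i] \<and> distinct ys \<and> set ys \<subseteq> V} = ?n * (?n - 1)"
      using cardV m card_lists_distinct_length_eq[OF fin, of 2]
      by (simp add: numeral_2_eq_2 numeral_eq_Suc atLeastAtMostSuc_conv)
    have "card {p\<in>S. L p i} * (?n * (?n - 1)) = N * card ?P"
      using card_permutes_map_in[OF fin d P] unfolding eq D N_def .
    also have "\<dots> \<le> N * (?n * k)"
      using card_adjacent_pairs_le[OF fin deg] by (intro mult_left_mono) auto
    finally have "?n * (card {p\<in>S. L p i} * (?n - 1)) \<le> ?n * (N * k)"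
      by (simp add: ac_simps)
    then have "card {p\<in>S. L p i} * (?n - 1) \<le> N * k"
      unfolding mult_le_cancel1 using cardV by simp
    then have "card {p\<in>S. L p i} * (2 * m) \<le> N * k"
      using cardV by simp
    then show ?thesis
      by (metis (mono_tags, lifting) mult.commute of_nat_le_iff of_nat_mult of_nat_numeral)
  qed
  \<comment> \<open>The same with lists of four vertices: the left factor is
    \<open>(n - 1) (n - 2) (n - 3)\<close> written in terms of \<open>m\<close>.\<close>
  have C_le: "(2 * real m - 1) * (4 * real m * (real m - 1)) * card {p\<in>S. C p i j}
      \<le> real N * (k * ((k - 1) * (k - 1)))" if j: "j < m" and i: "i < j" for i j
  proof -
    let ?P = "{[x, x', y, y'] |x x' y y'. {x, x', y, y'} \<subseteq> V \<and> distinct [x, x', y, y'] \<and>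
           R x y \<and> R x y' \<and> R x' y \<and> R x' y'}"
    let ?xs = "[a i, b i, a j, b j]"
    have d: "distinct ?xs" "set ?xs \<subseteq> V"
      using i j ab neq[of i i] neq[of i j] neq[of j i] neq[of j j] aa[of i j] bb[of i j] by auto
    have P: "?P \<subseteq> {ys. length ys = length ?xs \<and> distinct ys \<and> set ys \<subseteq> V}"
      by auto
    have "map p ?xs \<in> ?P \<longleftrightarrow> C p i j" if "p permutes V" for p
      using d permutes_in_image[OF that] permutes_inj[OF that, THEN inj_eq] by (simp add: C_def)
    then have eq: "{p\<in>S. C p i j} = {p. p permutes V \<and> map p ?xs \<in> ?P}"
      by (intro Collect_cong) (simp only: S_def mem_Collect_eq cong: conj_cong)
    have D: "card {ys::'a list. length ys = length ?xs \<and> distinct ys \<and> set ys \<subseteq> V}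
        = ?n * ((?n - 1) * ((?n - 2) * (?n - 3)))"
    proof -
      \<comment> \<open>Writing \<open>m = q + 2\<close> removes the truncated subtractions, so that
        the falling factorial expands into four explicit factors.\<close>
      obtain q where q: "m = Suc (Suc q)"
        using m by (metis Suc_le_D numeral_2_eq_2 Suc_le_mono)
      have n: "?n = 2 * q + 5" "?n - 1 = 2 * q + 4" "?n - 2 = 2 * q + 3" "?n - 3 = 2 * q + 2"
        using cardV q by auto
      then have "{?n - 4 + 1..?n} = {2 * q + 2, 2 * q + 3, 2 * q + 4, 2 * q + 5}"
        by auto
      then have "\<Prod>{?n - 4 + 1..?n} = (2 * q + 5) * ((2 * q + 4) * ((2 * q + 3) * (2 * q + 2)))"
        by (simp only:) (simp add: algebra_simps)
      moreover have "length ?xs = 4" "4 \<le> ?n"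
        using n by auto
      ultimately show ?thesis
        using card_lists_distinct_length_eq[OF fin, of 4] unfolding n(2-4) by (simp only: n(1))
    qed
    have "card {p\<in>S. C p i j} * (?n * ((?n - 1) * ((?n - 2) * (?n - 3)))) = N * card ?P"
      using card_permutes_map_in[OF fin d P] unfolding eq D N_def .
    also have "\<dots> \<le> N * (?n * (k * ((k - 1) * (k - 1))))"
      using card_four_cycles_le[OF fin sym deg] by (intro mult_left_mono) auto
    finally have "?n * (((?n - 1) * ((?n - 2) * (?n - 3))) * card {p\<in>S. C p i j})
        \<le> ?n * (N * (k * ((k - 1) * (k - 1))))"
      by (simp only: ac_simps)
    then have "((?n - 1) * ((?n - 2) * (?n - 3))) * card {p\<in>S. C p i j} \<le> N * (k * ((k - 1) * (k - 1)))"
      unfolding mult_le_cancel1 using cardV by simp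
    then have "real (((?n - 1) * ((?n - 2) * (?n - 3))) * card {p\<in>S. C p i j})
        \<le> real (N * (k * ((k - 1) * (k - 1))))"
      by (rule of_nat_mono)
    moreover have "real (?n - 1) = 2 * real m" "real (?n - 2) = 2 * real m - 1"
      "real (?n - 3) = 2 * (real m - 1)"
      using cardV m by auto
    ultimately show ?thesis
      by (simp only: of_nat_mult) (simp add: algebra_simps)
  qed
  have "\<exists>p\<in>S. w p < s"
  \<comment> \<open>Otherwise the total weight over all permutations is at least
    \<open>N * s\<close>; exchanging the sums and applying the two bounds makes it smaller than
    \<open>N * s\<close>.\<close>
  proof (rule ccontr)
    assume "\<not> (\<exists>p\<in>S. w p < s)"
    then have "(\<Sum>p\<in>S. real s) \<le> (\<Sum>p\<in>S. real (w p))"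
      by (intro sum_mono) auto
    then have "real N * s \<le> (\<Sum>p\<in>S. real (w p))"
      using cardS by simp
    also have "\<dots> = (\<Sum>p\<in>S. (\<Sum>i<m. of_bool (L p i)) + (\<Sum>j<m. \<Sum>i<j. of_bool (C p i j)))"
    proof (rule sum.cong[OF refl])
      fix p
      have "{(j, i). j < m \<and> i < j \<and> C p i j} = (SIGMA j:{..<m}. {i\<in>{..<j}. C p i j})"
        by auto
      then show "real (w p) = (\<Sum>i<m. of_bool (L p i)) + (\<Sum>j<m. \<Sum>i<j. of_bool (C p i j))"
        by (simp add: w_def sum.If_cases Int_def of_bool_def)
    qed
    also have "\<dots> = (\<Sum>i<m. \<Sum>p\<in>S. of_bool (L p i)) + (\<Sum>j<m. \<Sum>i<j. \<Sum>p\<in>S. of_bool (C p i j))"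
      by (simp only: sum.distrib sum.swap[of _ _ S])
    also have "\<dots> = (\<Sum>i<m. real (card {p\<in>S. L p i})) + (\<Sum>j<m. \<Sum>i<j. real (card {p\<in>S. C p i j}))"
      using finS by (simp add: sum.If_cases Int_def of_bool_def)
    also have "\<dots> \<le> (\<Sum>i<m. real N * k / (2 * real m)) +
        (\<Sum>j<m. \<Sum>i<j. real N * (k * ((k - 1) * (k - 1))) / ((2 * real m - 1) * (4 * real m * (real m - 1))))"
      using L_le C_le m
      by (intro add_mono sum_mono) (auto simp: pos_le_divide_eq mult.commute)
    also have "\<dots> = real N * k / 2 + (\<Sum>j<m. real j) *
        (real N * (k * ((k - 1) * (k - 1))) / ((2 * real m - 1) * (4 * real m * (real m - 1))))"
      using m by (simp add: sum_distrib_right sum_divide_distrib)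
    also have "(\<Sum>j<m. real j) = real m * (real m - 1) / 2"
      by (induction m) (auto simp: field_simps)
    also have "real N * k / 2 + real m * (real m - 1) / 2 *
        (real N * (k * ((k - 1) * (k - 1))) / ((2 * real m - 1) * (4 * real m * (real m - 1))))
        = real N * (real k / 2 + real (k * ((k - 1) * (k - 1))) / (8 * (2 * real m - 1)))"
      using m by (simp add: divide_simps) (simp add: algebra_simps)
    also have "\<dots> < real N * s"
      using small by (intro mult_strict_left_mono) (auto simp: N_def)
    finally show False by simp
  qed
  then obtain p where p: "p permutes V" and wp: "w p < s"
    by (auto simp: S_def)
  have inj: "p x = p y \<longleftrightarrow> x = y" for x y
    using permutes_inj[OF p] by (auto dest: injD)
  show thesis
  proof (rule that[of "p \<circ> a" "p \<circ> b"])
    show "card {i. i < m \<and> R ((p \<circ> a) i) ((p \<circ> b) i)} + card {(j, i). j < m \<and> i < j \<and>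
       R ((p \<circ> a) i) ((p \<circ> a) j) \<and> R ((p \<circ> a) i) ((p \<circ> b) j) \<and>
       R ((p \<circ> b) i) ((p \<circ> a) j) \<and> R ((p \<circ> b) i) ((p \<circ> b) j)} < s"
      using wp by (simp add: w_def L_def C_def)
  qed (use ab aa bb neq inj p in \<open>auto simp: inj_on_def permutes_in_image\<close>)
qed

section \<open>Building connected matchings\<close>

text \<open>Every construction below yields edges as indexed endpoints \<open>a i\<close>,
  \<open>b i\<close>; this converts such a family into a set of two-element sets, as
  \<open>cm\<close> demands.\<close>

lemma card_le_cm:
  assumes G: "simple_graph V E" and "finite I"
    and edge: "\<And>i. i \<in> I \<Longrightarrow> E (a i) (b i)"
    and disj: "\<And>i j. i \<in> I \<Longrightarrow> j \<in> I \<Longrightarrow> i \<noteq> j \<Longrightarrow> a i \<noteq> a j \<and> b i \<noteq> b j \<and> a i \<noteq> b j"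
    and conn: "\<And>i j. i \<in> I \<Longrightarrow> j \<in> I \<Longrightarrow> i \<noteq> j \<Longrightarrow>
      E (a i) (a j) \<or> E (a i) (b j) \<or> E (b i) (a j) \<or> E (b i) (b j)"
  shows "card I \<le> cm V E"
proof -
  let ?M = "(\<lambda>i. {a i, b i}) ` I"
  have *: "{a i, b i} \<inter> {a j, b j} = {}" if "i \<in> I" "j \<in> I" "i \<noteq> j" for i j
    using disj[of i j] disj[of j i] that by auto
  have **: "\<exists>x\<in>{a i, b i}. \<exists>y\<in>{a j, b j}. E x y" if "i \<in> I" "j \<in> I" "i \<noteq> j" for i j
    using conn[OF that] by auto
  have ef: "e \<inter> f = {} \<and> (\<exists>x\<in>e. \<exists>y\<in>f. E x y)" if "e \<in> ?M" "f \<in> ?M" "e \<noteq> f" for e f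
  proof -
    obtain i j where "i \<in> I" "j \<in> I" "e = {a i, b i}" "f = {a j, b j}" "i \<noteq> j"
      using \<open>e \<in> ?M\<close> \<open>f \<in> ?M\<close> \<open>e \<noteq> f\<close> by blast
    then show ?thesis
      using * ** by (simp only: simp_thms)
  qed
  have "connected_matching E ?M"
    unfolding connected_matching_def matching_def is_edge_def
  proof (intro conjI ballI impI)
    show "\<exists>x y. e = {x, y} \<and> E x y" if "e \<in> ?M" for e
      using edge that by (elim imageE) blast
  qed (use ef in blast)+
  moreover have "card ?M = card I"
    using disj by (intro card_image inj_onI) (metis doubleton_eq_iff)
  \<comment> \<open>Finiteness is what makes the \<open>Max\<close> in \<open>cm\<close> an upper
    bound for the sizes of connected matchings.\<close>
  moreover have "finite {M. connected_matching E M}"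
  proof (rule finite_subset)
    show "{M. connected_matching E M} \<subseteq> Pow (Pow V)"
    proof (intro subsetI, elim CollectE, intro PowI subsetI)
      fix M e x assume "connected_matching E M" "e \<in> M" "x \<in> e"
      then have "is_edge E e"
        by (simp add: connected_matching_def matching_def)
      then obtain y z where "e = {y, z}" "E y z"
        unfolding is_edge_def by (elim exE conjE)
      then show "x \<in> V"
        using \<open>x \<in> e\<close> G unfolding simple_graph_def by blast
    qed
    show "finite (Pow (Pow V))"
      using G by (simp add: simple_graph_def)
  qed
  ultimately show ?thesis
    unfolding cm_def by (intro Max_ge) (auto intro: image_eqI[of _ _ ?M])
qed

text \<open>Greedy choice: when the last element is served, fewer than \<open>card T\<close> values
  are taken, so its list still has a free one.\<close>

lemma ex_inj_choice:
  assumes "finite T" "\<And>v. v \<in> T \<Longrightarrow> card T \<le> card (A v)"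
  shows "\<exists>u. inj_on u T \<and> (\<forall>v\<in>T. u v \<in> A v)"
  using assms
proof (induction T rule: finite_induct)
  case empty
  then show ?case by simp
next
  case (insert x T)
  have "card T \<le> card (A v)" if "v \<in> T" for v
    using insert.prems[of v] insert.hyps that by simp
  then obtain u where u: "inj_on u T" "\<forall>v\<in>T. u v \<in> A v"
    using insert.IH by blast
  have "card (u ` T) < card (A x)"
    using insert.prems[of x] insert.hyps card_image_le[of T u] by simp
  then obtain y where "y \<in> A x" "y \<notin> u ` T"
    by (metis card_mono finite_imageI insert.hyps(1) not_le subsetI)
  then show ?case
    using u insert.hyps by (intro exI[of _ "u(x := y)"]) (auto simp: inj_on_def)
qed

section \<open>Non-neighbours and cliques when the independence number is at most 2\<close>

definition non_nbrs :: "'a set \<Rightarrow> ('a \<Rightarrow> 'a \<Rightarrow> bool) \<Rightarrow> 'a \<Rightarrow> 'a set" where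
  "non_nbrs V E v = {u \<in> V. u \<noteq> v \<and> \<not> E v u}"

definition clique :: "'a set \<Rightarrow> ('a \<Rightarrow> 'a \<Rightarrow> bool) \<Rightarrow> 'a set \<Rightarrow> bool" where
  "clique V E K \<longleftrightarrow> K \<subseteq> V \<and> (\<forall>x\<in>K. \<forall>y\<in>K. x \<noteq> y \<longrightarrow> E x y)"

lemma alpha_le_2D:
  assumes "simple_graph V E" "alpha V E \<le> 2"
    and "x \<in> V" "y \<in> V" "z \<in> V" "x \<noteq> y" "y \<noteq> z" "x \<noteq> z"
  shows "E x y \<or> E y z \<or> E x z"
proof (rule ccontr)
  assume "\<not> ?thesis"
  then have "independent_set V E {x, y, z}"
    using assms unfolding independent_set_def simple_graph_def by auto
  moreover have "finite {S. independent_set V E S}"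
    by (rule finite_subset[of _ "Pow V"])
      (use assms(1) in \<open>auto simp: independent_set_def simple_graph_def\<close>)
  ultimately have "card {x, y, z} \<le> alpha V E"
    unfolding alpha_def by (intro Max_ge) auto
  then show False
    using assms by simp
qed

text \<open>Two non-adjacent non-neighbours of \<open>v\<close> would form an independent triple
  with \<open>v\<close>. Hence the largest clique size bounds every degree in the
  complement.\<close>

lemma clique_non_nbrs:
  assumes "simple_graph V E" "alpha V E \<le> 2" "v \<in> V"
  shows "clique V E (non_nbrs V E v)"
  unfolding clique_def
proof (intro conjI ballI impI)
  fix x y assume "x \<in> non_nbrs V E v" "y \<in> non_nbrs V E v" "x \<noteq> y"
  then show "E x y"
    using alpha_le_2D[OF assms(1,2), of v x y] assms(3) by (auto simp: non_nbrs_def)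
qed (auto simp: non_nbrs_def)

section \<open>Large cliques: greedy matchings\<close>

text \<open>Each vertex of a \<open>t\<close>-subset \<open>T\<close> of \<open>K\<close> is joined
  to a private neighbour outside \<open>T\<close>; any two of these edges are connected inside the
  clique \<open>T\<close>.\<close>

lemma cm_ge_if_clique:
  assumes G: "simple_graph V E" and a2: "alpha V E \<le> 2" and n: "card V = 4 * t - 1"
    and K: "clique V E K" and tK: "t \<le> card K"
    and max: "\<And>L. clique V E L \<Longrightarrow> card L \<le> card K"
  shows "t \<le> cm V E"
proof -
  have fin: "finite V"
    using G by (simp add: simple_graph_def)
  have KV: "K \<subseteq> V"
    using K by (simp add: clique_def)
  obtain T where T: "T \<subseteq> K" "card T = t" "finite T"
    using obtain_subset_with_card_n[OF tK] by metis
  have cT: "E x y" if "x \<in> T" "y \<in> T" "x \<noteq> y" for x y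
    using K T(1) that by (auto simp: clique_def)
  define A where "A v = V - T - non_nbrs V E v" for v
  have "card T \<le> card (A v)" if "v \<in> T" for v
  proof (cases "card K < 2 * t")
    \<comment> \<open>Removing \<open>T\<close> and at most \<open>2t - 1\<close> non-neighbours
      from \<open>4t - 1\<close> vertices leaves at least \<open>t\<close> candidates.\<close>
    case True
    have "v \<in> V"
      using that T KV by auto
    then have "card (non_nbrs V E v) < 2 * t"
      using True max[OF clique_non_nbrs[OF G a2]] by fastforce
    moreover have "V \<subseteq> A v \<union> (T \<union> non_nbrs V E v)"
      by (auto simp: A_def)
    then have "card V \<le> card (A v \<union> (T \<union> non_nbrs V E v))"
      by (rule card_mono[rotated]) (use fin T(3) in \<open>simp add: A_def non_nbrs_def\<close>)
    then have "card V \<le> card (A v) + card (T \<union> non_nbrs V E v)"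
      using card_Un_le order_trans by blast
    ultimately show ?thesis
      using n T(2) card_Un_le[of T "non_nbrs V E v"] by linarith
  next
    case False
    \<comment> \<open>Here the rest of the clique alone supplies at least \<open>t\<close>
      candidates.\<close>
    have "K - T \<subseteq> A v"
      using K KV T(1) that unfolding A_def clique_def non_nbrs_def by auto
    then have "card (K - T) \<le> card (A v)"
      by (rule card_mono[rotated]) (use fin in \<open>simp add: A_def\<close>)
    then show ?thesis
      using False T card_Diff_subset[OF T(3,1)] by linarith
  qed
  then obtain u where u: "inj_on u T" "\<forall>v\<in>T. u v \<in> A v"
    using ex_inj_choice[OF T(3)] by metis
  have "card T \<le> cm V E"
  proof (rule card_le_cm[OF G T(3), of "\<lambda>v. v" u])
    show "E v (u v)" if "v \<in> T" for v
      using u(2) that by (auto simp: A_def non_nbrs_def)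
    show "i \<noteq> j \<and> u i \<noteq> u j \<and> i \<noteq> u j" if "i \<in> T" "j \<in> T" "i \<noteq> j" for i j
      using u that by (auto simp: A_def inj_on_def)
  qed (use cT in blast)
  then show ?thesis
    using T(2) by simp
qed

text \<open>The clique yields only \<open>t - 1\<close> edges; the missing one is an edge
  \<open>{x, y}\<close> outside \<open>K\<close>, to which the others connect through
  \<open>x\<close>.\<close>

lemma cm_ge_if_clique_pred:
  assumes G: "simple_graph V E" and a2: "alpha V E \<le> 2" and n: "card V = 4 * t - 1"
    and K: "clique V E K" and tK: "card K + 1 = t"
    and max: "\<And>L. clique V E L \<Longrightarrow> card L \<le> card K"
  shows "t \<le> cm V E"
proof -
  have fin: "finite V"
    using G by (simp add: simple_graph_def)
  have KV: "K \<subseteq> V"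
    using K by (simp add: clique_def)
  have finK: "finite K"
    using KV fin by (rule finite_subset)
  have cK: "E x y" if "x \<in> K" "y \<in> K" "x \<noteq> y" for x y
    using K that by (auto simp: clique_def)
  have sym: "E x y \<Longrightarrow> E y x" for x y
    using G by (auto simp: simple_graph_def)
  have cardVK: "card (V - K) = 3 * t"
    using n tK card_Diff_subset[OF finK KV] by simp
  \<comment> \<open>Among any three vertices outside \<open>K\<close> two are adjacent, which gives
    the extra edge.\<close>
  then have "3 \<le> card (V - K)"
    using tK by simp
  then obtain Z where Z: "Z \<subseteq> V - K" "card Z = 3"
    by (meson obtain_subset_with_card_n)
  then obtain z1 z2 z3 where "Z = {z1, z2, z3}" "z1 \<noteq> z2" "z2 \<noteq> z3" "z1 \<noteq> z3"
    by (metis card_3_iff)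
  with Z alpha_le_2D[OF G a2, of z1 z2 z3]
  obtain x y where xy: "x \<in> V - K" "y \<in> V - K" "E x y"
    by (metis DiffD1 insert_subset)
  have "x \<noteq> y"
    using xy G by (auto simp: simple_graph_def)
  have degle: "card (non_nbrs V E v) \<le> card K" if "v \<in> V" for v
    using that max clique_non_nbrs[OF G a2] by blast
  \<comment> \<open>Avoiding the non-neighbours of \<open>x\<close> keeps every chosen edge connected to \<open>{x, y}\<close>.\<close>
  define A where "A v = V - K - (non_nbrs V E v \<union> (non_nbrs V E x \<union> {x, y}))" for v
  have "card K \<le> card (A v)" if "v \<in> K" for v
  proof -
    \<comment> \<open>At most \<open>2 (t - 1) + 2 = 2t\<close> of the \<open>3t\<close> outside
      vertices are forbidden, so \<open>t > card K\<close> remain.\<close>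
    have "card (non_nbrs V E v \<union> (non_nbrs V E x \<union> {x, y})) \<le> card K + (card K + 2)"
      using degle[of v] degle[of x] that KV xy \<open>x \<noteq> y\<close>
        card_Un_le[of "non_nbrs V E v" "non_nbrs V E x \<union> {x, y}"]
        card_Un_le[of "non_nbrs V E x" "{x, y}"] by auto
    moreover have "card (V - K) - card (non_nbrs V E v \<union> (non_nbrs V E x \<union> {x, y})) \<le> card (A v)"
      unfolding A_def using fin by (intro diff_card_le_card_Diff) (auto simp: non_nbrs_def)
    ultimately show ?thesis
      using cardVK tK by linarith
  qed
  then obtain u where u: "inj_on u K" "\<forall>v\<in>K. u v \<in> A v"
    using ex_inj_choice[OF finK] by metis
  have "card (insert x K) \<le> cm V E"
  proof (rule card_le_cm[OF G, of _ "\<lambda>v. v" "u(x := y)"])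
    show "E v ((u(x := y)) v)" if "v \<in> insert x K" for v
      using u(2) that xy by (auto simp: A_def non_nbrs_def)
    show "i \<noteq> j \<and> (u(x := y)) i \<noteq> (u(x := y)) j \<and> i \<noteq> (u(x := y)) j"
      if "i \<in> insert x K" "j \<in> insert x K" "i \<noteq> j" for i j
      using u that xy \<open>x \<noteq> y\<close> by (auto simp: A_def inj_on_def)
    have "E x (u v)" if "v \<in> K" for v
      using u(2) that by (auto simp: A_def non_nbrs_def)
    then show "E i j \<or> E i ((u(x := y)) j) \<or> E ((u(x := y)) i) j \<or> E ((u(x := y)) i) ((u(x := y)) j)"
      if "i \<in> insert x K" "j \<in> insert x K" "i \<noteq> j" for i j
      using cK[of i j] sym[of x "u i"] that by auto
  qed (use finK in simp)
  then show ?thesis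
    using tK xy finK by simp
qed

section \<open>Small cliques: random pairing and deletion\<close>

text \<open>Of \<open>2t - 1\<close> pairs with fewer than \<open>t\<close> conflicts, one pair per
  conflict is deleted, and at least \<open>t\<close> survive. Here \<open>k\<close> is just the
  degree bound \<open>t - 2\<close>, so it need not be attained.\<close>

lemma cm_ge_if_few_non_nbrs:
  assumes G: "simple_graph V E" and t: "k + 2 = t" "t \<le> 22"
    and n: "card V = 4 * t - 1"
    and deg: "\<And>x. x \<in> V \<Longrightarrow> card (non_nbrs V E x) \<le> k"
  shows "t \<le> cm V E"
proof -
  have fin: "finite V"
    using G by (simp add: simple_graph_def)
  define R where "R x y \<longleftrightarrow> x \<noteq> y \<and> \<not> E x y" for x y
  have R_sym: "R x y \<Longrightarrow> R y x" for x y
    using G by (auto simp: R_def simple_graph_def)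
  have R_deg: "card {y\<in>V. R x y} \<le> k" if "x \<in> V" for x
    using deg[OF that] by (simp add: R_def non_nbrs_def eq_commute conj_commute)
  define m where "m = 2 * t - 1"
  \<comment> \<open>This is \<open>small\<close> with \<open>s = k + 2\<close> and
    \<open>2m - 1 = 4k + 5\<close> after clearing denominators; \<open>t \<le> 22\<close> means
    \<open>k \<le> 20\<close>, and these cases are evaluated.\<close>
  have "\<forall>k\<in>set [0..<21]. k * ((k - 1) * (k - 1)) < 4 * (k + 4) * (4 * k + 5)"
    by code_simp
  moreover have "k \<in> set [0..<21]"
    using t by simp
  ultimately have "k * ((k - 1) * (k - 1)) < 4 * (k + 4) * (4 * k + 5)"
    unfolding atMost_nat_numeral by auto
  then have "real (k * ((k - 1) * (k - 1))) < real (4 * (k + 4) * (4 * k + 5))"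
    by (rule of_nat_less_iff[THEN iffD2])
  moreover have "2 * real m - 1 = 4 * real k + 5"
    using t by (simp add: m_def)
  ultimately have small: "real k / 2 + real (k * ((k - 1) * (k - 1))) / (8 * (2 * real m - 1)) < real t"
    using t by (auto simp: field_simps)
  have "card V = 2 * m + 1" "2 \<le> m"
    using n t by (auto simp: m_def)
  then obtain a b :: "nat \<Rightarrow> 'a" where ab: "\<forall>i<m. a i \<in> V \<and> b i \<in> V"
    "\<forall>i<m. \<forall>j<m. a i \<noteq> b j" "inj_on a {..<m}" "inj_on b {..<m}"
    and few: "card {i. i < m \<and> R (a i) (b i)} + card {(j, i). j < m \<and> i < j \<and>
       R (a i) (a j) \<and> R (a i) (b j) \<and> R (b i) (a j) \<and> R (b i) (b j)} < t"
    (is "card ?L + card ?C < t")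
    by (rule ex_pairing_few_conflicts[where R = R, OF fin _ _ R_sym R_deg small]) (assumption | rule that)+
  \<comment> \<open>From each unconnected couple \<open>fst\<close> removes the larger
    index.\<close>
  define I where "I = {..<m} - (?L \<union> fst ` ?C)"
  have "finite ?C"
    by (rule finite_subset[of _ "{..<m} \<times> {..<m}"]) auto
  then have "card (?L \<union> fst ` ?C) < t"
    using few card_Un_le[of ?L "fst ` ?C"] card_image_le[of ?C fst] by linarith
  then have "t \<le> card I"
    using diff_card_le_card_Diff[of "?L \<union> fst ` ?C" "{..<m}"] \<open>finite ?C\<close>
    unfolding I_def[symmetric] by (simp add: m_def)
  also have "card I \<le> cm V E"
  proof (rule card_le_cm[OF G, of _ a b])
    show "E (a i) (b i)" if "i \<in> I" for i
      using that ab(2) by (auto simp: I_def R_def)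
    show disj: "a i \<noteq> a j \<and> b i \<noteq> b j \<and> a i \<noteq> b j" if "i \<in> I" "j \<in> I" "i \<noteq> j" for i j
      using that ab by (auto simp: I_def inj_on_def)
    \<comment> \<open>\<open>?C\<close> records couples only with \<open>i < j\<close>; the other
      order follows from the symmetry of \<open>E\<close>. Between distinct vertices a failure of
      \<open>R\<close> is an edge.\<close>
    have less: "E (a i) (a j) \<or> E (a i) (b j) \<or> E (b i) (a j) \<or> E (b i) (b j)"
      if "i \<in> I" "j \<in> I" "i < j" for i j
    proof -
      have "(j, i) \<notin> ?C" "j < m"
        using that by (force simp: I_def)+
      then show ?thesis
        using that disj[of i j] disj[of j i] by (auto simp: R_def)
    qed
    show "E (a i) (a j) \<or> E (a i) (b j) \<or> E (b i) (a j) \<or> E (b i) (b j)"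
      if "i \<in> I" "j \<in> I" "i \<noteq> j" for i j
    proof -
      have "E x y \<Longrightarrow> E y x" for x y
        using G by (auto simp: simple_graph_def)
      then show ?thesis
        using less[of i j] less[of j i] that by (metis linorder_neqE_nat)
    qed
  qed (simp add: I_def)
  finally show ?thesis .
qed

section \<open>Case distinction on the clique number\<close>

theorem theorem1p6:
  fixes V :: "'a set" and E :: "'a \<Rightarrow> 'a \<Rightarrow> bool" and t :: nat
  assumes "simple_graph V E"
    and "1 \<le> t" and "t \<le> 22"
    and "card V = 4 * t - 1"
    and "alpha V E = 2"
  shows "cm V E \<ge> t"
proof -
  have fin: "finite V"
    using assms(1) by (simp add: simple_graph_def)
  have a2: "alpha V E \<le> 2"
    using assms(5) by simp
  \<comment> \<open>The empty clique and the bound \<open>card V\<close> guarantee that a largest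
    clique exists.\<close>
  have "clique V E {}"
    by (simp add: clique_def)
  moreover have "card K \<le> card V" if "clique V E K" for K
    using that fin by (auto simp: clique_def intro: card_mono)
  ultimately have "\<exists>K. clique V E K \<and> (\<forall>L. clique V E L \<longrightarrow> card L \<le> card K)"
    by (intro ex_has_greatest_nat[where b = "Suc (card V)"]) (auto simp: less_Suc_eq_le)
  then obtain K where K: "clique V E K" and max: "\<And>L. clique V E L \<Longrightarrow> card L \<le> card K"
    by blast
  consider "t \<le> card K" | "card K + 1 = t" | "card K + 2 \<le> t"
    by linarith
  then show ?thesis
  proof cases
    case 1
    then show ?thesis
      using cm_ge_if_clique[OF assms(1) a2 assms(4) K] max by blast
  next
    case 2
    then show ?thesis
      using cm_ge_if_clique_pred[OF assms(1) a2 assms(4) K] max by blast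
  next
    case 3
    have "card (non_nbrs V E x) \<le> t - 2" if "x \<in> V" for x
      using max[OF clique_non_nbrs[OF assms(1) a2 that]] 3 by simp
    then show ?thesis
      using cm_ge_if_few_non_nbrs[OF assms(1) _ assms(3,4), of "t - 2"] 3 by auto
  qed
qed

end
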